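(* Let $X$ be an arbitrary bounded metric space, let $\lambda>0$ be a real number, and let $\lambda\Delta$ be a simplex all of whose non-zero distances equal $\lambda$, of cardinality $m=\#\lambda\Delta\le\#X$. Suppose that $d_m(X)=\operatorname{diam}X$. Then $$2d_{GH}(\lambda\Delta,X)=\max\{\operatorname{diam}X,\ \lambda-\alpha_m(X)\}.$$ In particular, (1) if $\lambda\le\operatorname{diam}X+\alpha_m(X)$, then $2d_{GH}(\lambda\Delta,X)=\operatorname{diam}X$; (2) if $\lambda\ge\operatorname{diam}X+\alpha_m(X)$, then $2d_{GH}(\lambda\Delta,X)=\lambda-\alpha_m(X)$.
   Context: Metric spaces are assumed non-empty. $\#X$ denotes the cardinality of $X$; $|xy|$ denotes the distance between points $x,y$. A simplex is a metric space all of whose non-zero distances are equal; $\lambda\Delta$ denotes a simplex whose non-zero distances all equal $\lambda>0$ (its cardinality may be any finite or infinite non-zero cardinal). For metric spaces $X,Y$, the Gromov--Hausdorff distance $d_{GH}(X,Y)$ is the infimum of real numbers $r$ for which there exist a metric space $Z$ and subsets $X',Y'\subset Z$ isometric to $X$ and $Y$, respectively, such that $d_H(X',Y')\le r$, where $d_H$ is the Hausdorff distance in $Z$. For a cardinal number $m\le\#X$ let $\mathcal{D}_m(X)$ be the set of all partitions of $X$ into $m$ non-empty subsets. For $D=\{X_i\}_{i\in I}\in\mathcal{D}_m(X)$ put $\operatorname{diam}D=\sup_{i\in I}\operatorname{diam}X_i$ and $\alpha(D)=\inf\{|X_iX_j| : i\ne j\}$, where $|AB|=\inf\{|ab| : a\in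 A,\ b\in B\}$ for non-empty $A,B\subset X$; for $m=1$ the infimum over the empty set is $\alpha(D)=+\infty$, and expressions are read in the extended reals. Put $$\alpha_m(X)=\sup_{D\in\mathcal{D}_m(X)}\alpha(D),\qquad d_m(X)=\inf_{D\in\mathcal{D}_m(X)}\operatorname{diam}D.$$ *)

theory Defs
  imports "HOL-Analysis.Analysis" "HOL-Library.Disjoint_Sets"
begin

text \<open>Diameters and distances take values in the extended reals. On non-empty sets the
  suprema and infima of points below are those of non-empty families of non-negative reals.\<close>

definition mdiam :: "'a metric \<Rightarrow> 'a set \<Rightarrow> ereal"
  where "mdiam X A = (SUP (x, y) \<in> A \<times> A. ereal (mdist X x y))"

definition mset_dist :: "'a metric \<Rightarrow> 'a set \<Rightarrow> 'a set \<Rightarrow> ereal"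
  where "mset_dist X A B = (INF (a, b) \<in> A \<times> B. ereal (mdist X a b))"

definition hausdorff_dist :: "'a metric \<Rightarrow> 'a set \<Rightarrow> 'a set \<Rightarrow> ereal"
  where "hausdorff_dist Z A B =
    max (SUP a \<in> A. mset_dist Z {a} B) (SUP b \<in> B. mset_dist Z A {b})"

definition isometric_onto :: "'a metric \<Rightarrow> 'c metric \<Rightarrow> 'c set \<Rightarrow> bool"
  where "isometric_onto X Z A \<longleftrightarrow> (\<exists>f. bij_betw f (mspace X) A \<and>
    (\<forall>x \<in> mspace X. \<forall>y \<in> mspace X. mdist Z (f x) (f y) = mdist X x y))"

text \<open>A definition cannot quantify over the type of points of the ambient space \<open>Z\<close>. Since
  only \<open>X' \<union> Y'\<close> matters, it is enough to let \<open>Z\<close> range over all metric spaces whose points lie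
  in the sum type; see \<open>GH_dist_le\<close> below.\<close>

definition GH_dist :: "'a metric \<Rightarrow> 'b metric \<Rightarrow> ereal"
  where "GH_dist X Y = Inf {ereal r | r. \<exists>(Z :: ('a + 'b) metric) X' Y'.
    X' \<subseteq> mspace Z \<and> Y' \<subseteq> mspace Z \<and> isometric_onto X Z X' \<and> isometric_onto Y Z Y' \<and>
    hausdorff_dist Z X' Y' \<le> ereal r}"

definition is_simplex :: "real \<Rightarrow> 'a metric \<Rightarrow> bool"
  where "is_simplex c S \<longleftrightarrow> mspace S \<noteq> {} \<and>
    (\<forall>x \<in> mspace S. \<forall>y \<in> mspace S. x \<noteq> y \<longrightarrow> mdist S x y = c)"

definition partitions_of_card :: "'m rel \<Rightarrow> 'a metric \<Rightarrow> 'a set set set"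
  where "partitions_of_card m X = {D. partition_on (mspace X) D \<and> (card_of D, m) \<in> ordIso}"

definition partition_diam :: "'a metric \<Rightarrow> 'a set set \<Rightarrow> ereal"
  where "partition_diam X D = (SUP A \<in> D. mdiam X A)"

text \<open>For a one-part partition the infimum is over the empty set, hence \<open>\<infinity>\<close>; then
  \<open>ereal c - \<infinity> = - \<infinity>\<close>.\<close>

definition partition_gap :: "'a metric \<Rightarrow> 'a set set \<Rightarrow> ereal"
  where "partition_gap X D = Inf {mset_dist X A B | A B. A \<in> D \<and> B \<in> D \<and> A \<noteq> B}"

definition alpha_card :: "'m rel \<Rightarrow> 'a metric \<Rightarrow> ereal"
  where "alpha_card m X = (SUP D \<in> partitions_of_card m X. partition_gap X D)"

definition d_card :: "'m rel \<Rightarrow> 'a metric \<Rightarrow> ereal"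
  where "d_card m X = (INF D \<in> partitions_of_card m X. partition_diam X D)"

lemma GH_dist_le:
  fixes X :: "'a metric" and Y :: "'b metric" and Z :: "'c metric"
  assumes sub: "X' \<subseteq> mspace Z" "Y' \<subseteq> mspace Z"
    and iso: "isometric_onto X Z X'" "isometric_onto Y Z Y'"
    and le: "hausdorff_dist Z X' Y' \<le> ereal r"
  shows "GH_dist X Y \<le> ereal r"
proof -
  obtain f where f: "bij_betw f (mspace X) X'"
      "\<forall>x \<in> mspace X. \<forall>y \<in> mspace X. mdist Z (f x) (f y) = mdist X x y"
    using iso(1) unfolding isometric_onto_def by blast
  obtain g where g: "bij_betw g (mspace Y) Y'"
      "\<forall>x \<in> mspace Y. \<forall>y \<in> mspace Y. mdist Z (g x) (g y) = mdist Y x y"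
    using iso(2) unfolding isometric_onto_def by blast
  define h :: "'c \<Rightarrow> 'a + 'b" where
    "h z = (if z \<in> X' then Inl (inv_into (mspace X) f z) else Inr (inv_into (mspace Y) g z))" for z
  define U where "U = X' \<union> Y'"
  define k where "k = inv_into U h"
  have injh: "inj_on h U"
  proof (rule inj_onI)
    fix z w assume zw: "z \<in> U" "w \<in> U" and eq: "h z = h w"
    have im: "f ` mspace X = X'" "g ` mspace Y = Y'" using f(1) g(1) by (auto simp: bij_betw_def)
    show "z = w"
    proof (cases "z \<in> X'")
      case True
      then have "w \<in> X'" "inv_into (mspace X) f z = inv_into (mspace X) f w"
        using eq by (simp_all add: h_def split: if_splits)
      then show ?thesis using True im(1) by (metis f_inv_into_f)
    next
      case False
      then have "w \<notin> X'" "inv_into (mspace Y) g z = inv_into (mspace Y) g w"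
        using eq by (simp_all add: h_def split: if_splits)
      moreover have "z \<in> Y'" "w \<in> Y'" using False zw \<open>w \<notin> X'\<close> by (auto simp: U_def)
      ultimately show ?thesis using im(2) by (metis f_inv_into_f)
    qed
  qed
  have kh: "k (h z) = z" if "z \<in> U" for z
    using that injh by (simp add: k_def)
  have dk: "Metric_space (h ` U) (\<lambda>u v. mdist Z (k u) (k v))"
  proof
    fix u v w
    show "0 \<le> mdist Z (k u) (k v)" by simp
    show "mdist Z (k u) (k v) = mdist Z (k v) (k u)" by (simp add: mdist_commute)
    assume uv: "u \<in> h ` U" "v \<in> h ` U"
    have mem: "k t \<in> mspace Z" if "t \<in> h ` U" for t
      using that kh sub by (auto simp: U_def)
    have "k u = k v \<longleftrightarrow> u = v" using uv kh by auto
    then show "mdist Z (k u) (k v) = 0 \<longleftrightarrow> u = v"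
      using mem uv by simp
    assume "w \<in> h ` U"
    then show "mdist Z (k u) (k w) \<le> mdist Z (k u) (k v) + mdist Z (k v) (k w)"
      using mem uv by (simp add: mdist_triangle)
  qed
  define W where "W = metric (h ` U, \<lambda>u v. mdist Z (k u) (k v))"
  have W: "mspace W = h ` U" "mdist W = (\<lambda>u v. mdist Z (k u) (k v))"
    using dk by (simp_all add: W_def Metric_space.mspace_metric Metric_space.mdist_metric)
  have sub': "h ` X' \<subseteq> mspace W" "h ` Y' \<subseteq> mspace W"
    by (auto simp: W U_def)
  have transfer: "isometric_onto V W (h ` A)"
    if "A \<subseteq> U" "bij_betw p (mspace V) A"
      "\<forall>x \<in> mspace V. \<forall>y \<in> mspace V. mdist Z (p x) (p y) = mdist V x y" for V :: "'v metric" and A p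
    unfolding isometric_onto_def
  proof (intro exI[of _ "h \<circ> p"] conjI ballI)
    have "bij_betw h A (h ` A)"
      using injh that(1) by (auto simp: bij_betw_def intro: inj_on_subset)
    with that(2) show "bij_betw (h \<circ> p) (mspace V) (h ` A)"
      by (rule bij_betw_trans)
    fix x y assume xy: "x \<in> mspace V" "y \<in> mspace V"
    then have "p x \<in> U" "p y \<in> U" using that(1,2) by (auto simp: bij_betw_def)
    then show "mdist W ((h \<circ> p) x) ((h \<circ> p) y) = mdist V x y"
      using that(3) xy by (simp add: W kh)
  qed
  have sd: "mset_dist W (h ` A) (h ` B) = mset_dist Z A B" if "A \<subseteq> U" "B \<subseteq> U" for A B
  proof -
    have "h ` A \<times> h ` B = map_prod h h ` (A \<times> B)" by auto
    moreover have "mdist W (h a) (h b) = mdist Z a b" if "a \<in> A" "b \<in> B" for a b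
      using that \<open>A \<subseteq> U\<close> \<open>B \<subseteq> U\<close> by (simp add: W kh subset_iff)
    ultimately show ?thesis unfolding mset_dist_def
      by (simp only: image_image) (intro INF_cong, auto)
  qed
  have sup1: "(SUP a \<in> h ` X'. mset_dist W {a} (h ` Y')) = (SUP a \<in> X'. mset_dist Z {a} Y')"
    unfolding image_image using sd[of "{a}" Y' for a] by (intro SUP_cong) (auto simp: U_def)
  have sup2: "(SUP b \<in> h ` Y'. mset_dist W (h ` X') {b}) = (SUP b \<in> Y'. mset_dist Z X' {b})"
    unfolding image_image using sd[of X' "{b}" for b] by (intro SUP_cong) (auto simp: U_def)
  have "hausdorff_dist W (h ` X') (h ` Y') \<le> ereal r"
    using le unfolding hausdorff_dist_def sup1 sup2 .
  moreover have "isometric_onto X W (h ` X')" "isometric_onto Y W (h ` Y')"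
    using transfer[of X' f X] transfer[of Y' g Y] f g by (auto simp: U_def)
  ultimately show ?thesis
    unfolding GH_dist_def using sub' by (intro Inf_lower) blast
qed

end

theory Submission
  imports Defs
begin

text \<open>
  Twice the Gromov--Hausdorff distance is the infimum of the distortions of correspondences between
  the two spaces, so the formula says how small the distortion of a correspondence \<open>R\<close> between the
  simplex and \<open>X\<close> can be. Let \<open>d\<close> be the diameter of \<open>X\<close> and \<open>\<rho>\<close> a bound for the distortion of \<open>R\<close>.

  Lower bound. Each set of points of \<open>X\<close> related to one vertex has diameter at most \<open>\<rho>\<close>. Choosing
  a vertex for every point turns these sets into a partition with at most \<open>m\<close> parts. Since
  \<open>m\<close> does not exceed the cardinality of \<open>X\<close>, it can be refined to exactly \<open>m\<close> parts
  (\<open>fibres_have_refinement_of_card\<close>), and refining does not increase diameters; hence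
  \<open>d\<^sub>m(X) \<le> \<rho>\<close> (\<open>d_card_le_distortion\<close>), and the hypothesis \<open>d\<^sub>m(X) = d\<close> gives \<open>d \<le> \<rho>\<close>. If moreover
  \<open>\<rho> < c\<close>, no point is related to two vertices, so \<open>R\<close> itself is a partition into \<open>m\<close> parts, whose
  mutual distances are at least \<open>c - \<rho>\<close>; hence \<open>c - \<rho> \<le> \<alpha>\<^sub>m(X)\<close> (\<open>simplex_distortion_ge_alpha\<close>).

  Upper bound. If \<open>\<rho>\<close> exceeds both \<open>d\<close> and \<open>c - \<alpha>\<^sub>m(X)\<close>, some partition into \<open>m\<close> parts has gap more
  than \<open>c - \<rho>\<close>. Matching its parts with the vertices, one can glue the simplex to \<open>X\<close> so that
  every point lies at distance \<open>\<rho> / 2\<close> from the vertex of its part (\<open>GH_dist_simplex_le\<close>).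
\<close>

section \<open>Partitions of a prescribed cardinality\<close>

text \<open>For infinite \<open>C\<close> any copy of \<open>C\<close> inside \<open>B\<close> absorbs \<open>A\<close>; for finite \<open>C\<close> exactly the missing
  number of elements is taken from such a copy, which has enough of them outside \<open>A\<close>.\<close>

lemma subset_of_intermediate_cardinality:
  assumes "A \<subseteq> B" "(card_of A, card_of C) \<in> ordLeq" "(card_of C, card_of B) \<in> ordLeq"
  obtains T where "A \<subseteq> T" "T \<subseteq> B" "(card_of T, card_of C) \<in> ordIso"
proof -
  obtain g where g: "inj_on g C" "g ` C \<subseteq> B"
    using assms(3) by (auto simp: card_of_ordLeq[symmetric])
  have gC: "(card_of (g ` C), card_of C) \<in> ordIso"
    using g(1) by (meson card_of_ordIso bij_betw_def ordIso_symmetric)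
  show thesis
  proof (cases "finite C")
    case True
    obtain k where k: "inj_on k A" "k ` A \<subseteq> C"
      using assms(2) by (auto simp: card_of_ordLeq[symmetric])
    have finA: "finite A" using k True by (meson finite_subset finite_imageD)
    have "card A \<le> card C" using k True by (meson card_inj_on_le)
    moreover have "card C = card (g ` C)" using g(1) by (simp add: card_image)
    ultimately obtain T0 where "T0 \<subseteq> g ` C - A" "card T0 = card C - card A"
    proof -
      have "card C - card A \<le> card (g ` C - A)"
        using diff_card_le_card_Diff[OF finA, of "g ` C"] \<open>card C = card (g ` C)\<close> by simp
      then show ?thesis using that by (meson obtain_subset_with_card_n)
    qed
    have "finite T0" "A \<inter> T0 = {}"
      using True \<open>T0 \<subseteq> _\<close> finite_subset[of T0 "g ` C"] by auto
    then have cd: "card (A \<union> T0) = card C" "finite (A \<union> T0)"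
      using finA \<open>card A \<le> card C\<close> \<open>card T0 = _\<close> card_Un_disjoint[of A T0] by simp_all
    obtain h where "bij_betw h (A \<union> T0) C"
      using finite_same_card_bij[OF cd(2) True cd(1)] by blast
    then have "(card_of (A \<union> T0), card_of C) \<in> ordIso" by (meson card_of_ordIso)
    then show thesis using that[of "A \<union> T0"] assms(1) g(2) \<open>T0 \<subseteq> _\<close> by blast
  next
    case False
    then have "infinite (g ` C)" using g(1) by (simp add: finite_image_iff)
    moreover have "(card_of A, card_of (g ` C)) \<in> ordLeq"
      using assms(2) gC by (meson ordIso_symmetric ordLeq_ordIso_trans)
    ultimately have "(card_of (A \<union> g ` C), card_of (g ` C)) \<in> ordIso"
      using card_of_Un_ordLeq_infinite_Field[of "card_of (g ` C)" A "g ` C"]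
      by (simp add: ordIso_iff_ordLeq card_of_Card_order card_of_mono1 Field_card_of
          card_of_card_order_on)
    then have "(card_of (A \<union> g ` C), card_of C) \<in> ordIso"
      using gC by (meson ordIso_transitive)
    then show thesis using that[of "A \<union> g ` C"] assms(1) g(2) by auto
  qed
qed

lemma fibres_in_partitions_of_card:
  assumes "h ` mspace X = T" "(card_of T, m) \<in> ordIso"
  shows "(\<lambda>t. {x \<in> mspace X. h x = t}) ` T \<in> partitions_of_card m X"
proof -
  let ?F = "\<lambda>t. {x \<in> mspace X. h x = t}"
  have part: "partition_on (mspace X) (?F ` T)"
    using assms(1) by (auto simp: partition_on_def disjoint_def)
  have "inj_on ?F T"
  proof (rule inj_onI)
    fix t u assume "t \<in> T" "u \<in> T" "?F t = ?F u"
    then obtain x where "x \<in> ?F t" using assms(1) by auto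
    moreover then have "x \<in> ?F u" using \<open>?F t = ?F u\<close> by simp
    ultimately show "t = u" by simp
  qed
  then have "(card_of (?F ` T), card_of T) \<in> ordIso"
    by (meson card_of_ordIso bij_betw_def ordIso_symmetric)
  then show ?thesis
    using part assms(2) by (auto simp: partitions_of_card_def intro: ordIso_transitive)
qed

text \<open>One representative is picked in every fibre, and the set of representatives is enlarged to
  a set \<open>T\<close> of the cardinality of \<open>C\<close>. The points of \<open>T\<close> that are not representatives are split off
  their fibres as singletons.\<close>

lemma fibres_have_refinement_of_card:
  assumes f: "\<And>x. x \<in> mspace X \<Longrightarrow> f x \<in> C"
    and C: "(card_of C, card_of (mspace X)) \<in> ordLeq"
  obtains D where "D \<in> partitions_of_card (card_of C) X"
    "\<And>A x y. A \<in> D \<Longrightarrow> x \<in> A \<Longrightarrow> y \<in> A \<Longrightarrow> x \<in> mspace X \<and> y \<in> mspace X \<and> f x = f y"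
proof -
  let ?X = "mspace X"
  define g where "g = inv_into ?X f"
  have g: "g (f x) \<in> ?X" "f (g (f x)) = f x" if "x \<in> ?X" for x
    using that by (auto simp: g_def inv_into_into f_inv_into_f)
  have "inj_on f (g ` f ` ?X)"
    by (rule inj_onI, elim imageE) (simp add: g)
  moreover have "f ` g ` f ` ?X \<subseteq> C"
    using f by (intro subsetI, elim imageE) (simp add: g)
  ultimately have "(card_of (g ` f ` ?X), card_of C) \<in> ordLeq"
    using card_of_ordLeq by blast
  moreover have "g ` f ` ?X \<subseteq> ?X" using g(1) by blast
  ultimately obtain T where T: "g ` f ` ?X \<subseteq> T" "T \<subseteq> ?X" "(card_of T, card_of C) \<in> ordIso"
    using subset_of_intermediate_cardinality[OF _ _ C] by metis
  define h where "h x = (if x \<in> T then x else g (f x))" for x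
  have "h x \<in> T" if "x \<in> ?X" for x using T(1) that unfolding h_def by auto
  moreover have "t \<in> h ` ?X" if "t \<in> T" for t
    using T(2) that by (intro image_eqI[of _ _ t]) (auto simp: h_def)
  ultimately have hX: "h ` ?X = T" by blast
  have fh: "f (h x) = f x" if "x \<in> ?X" for x
    using that by (simp add: h_def g)
  show thesis
  proof (rule that[OF fibres_in_partitions_of_card[OF hX T(3)]])
    fix A x y assume A: "A \<in> (\<lambda>t. {x \<in> ?X. h x = t}) ` T" "x \<in> A" "y \<in> A"
    then have xy: "x \<in> ?X" "y \<in> ?X" "h x = h y" by auto
    have "f x = f (h x)" using fh[OF xy(1)] by (rule sym)
    also have "\<dots> = f y" using fh[OF xy(2)] xy(3) by simp
    finally show "x \<in> ?X \<and> y \<in> ?X \<and> f x = f y" using xy by blast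
  qed
qed

text \<open>Naming the parts by the elements of \<open>C\<close> turns the partition into a map, so that the distance
  between different parts can be used point by point.\<close>

lemma partition_as_fibres:
  assumes "D \<in> partitions_of_card (card_of C) X"
  obtains f where "f ` mspace X = C"
    "\<And>x y. x \<in> mspace X \<Longrightarrow> y \<in> mspace X \<Longrightarrow> f x \<noteq> f y \<Longrightarrow>
      partition_gap X D \<le> ereal (mdist X x y)"
proof -
  have D: "partition_on (mspace X) D" and "(card_of D, card_of C) \<in> ordIso"
    using assms by (auto simp: partitions_of_card_def)
  then obtain b where b: "bij_betw b D C" by (meson card_of_ordIso)
  have "\<forall>x\<in>mspace X. \<exists>A. A \<in> D \<and> x \<in> A" using partition_onD1[OF D] by auto
  then obtain p where p: "\<And>x. x \<in> mspace X \<Longrightarrow> p x \<in> D \<and> x \<in> p x" by metis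
  have "A \<in> p ` mspace X" if A: "A \<in> D" for A
  proof -
    obtain x where x: "x \<in> A" using partition_onD3[OF D] A by fastforce
    then have "x \<in> mspace X" using partition_onD1[OF D] A by auto
    moreover then have "p x = A"
      using p[of x] x A partition_onD2[OF D] unfolding disjoint_def by blast
    ultimately show ?thesis by blast
  qed
  then have "p ` mspace X = D" using p by auto
  then have "(b \<circ> p) ` mspace X = C" using b by (metis bij_betw_def image_comp)
  moreover have "partition_gap X D \<le> ereal (mdist X x y)"
    if "x \<in> mspace X" "y \<in> mspace X" "(b \<circ> p) x \<noteq> (b \<circ> p) y" for x y
  proof -
    have "p x \<noteq> p y" using that by auto
    then have "partition_gap X D \<le> mset_dist X (p x) (p y)"
      unfolding partition_gap_def using p that by (intro Inf_lower) blast
    also have "\<dots> \<le> ereal (mdist X x y)"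
      unfolding mset_dist_def using p that by (intro INF_lower2[of "(x, y)"]) auto
    finally show ?thesis .
  qed
  ultimately show thesis using that by blast
qed

section \<open>The upper bound: gluing the simplex to the space\<close>

text \<open>On the disjoint union a vertex \<open>s\<close> has distance \<open>r\<close> to the points of its fibre and \<open>r + e\<close> to
  all others, where \<open>e = max 0 (c - 2 * r)\<close>. The triangle inequality confines \<open>e\<close> from two sides:
  a point joins two vertices by a path of length at least \<open>2 * r + e\<close>, which must not be
  less than \<open>c\<close>, while leaving a fibre costs \<open>e\<close>, which must not exceed the distance between fibres.
  The bound on the diameter covers the shortcuts through a single vertex, and \<open>r > 0\<close> keeps vertices
  and points distinct.\<close>

lemma GH_dist_simplex_le:
  fixes X :: "'a metric" and S :: "'b metric"
  assumes S: "is_simplex c S" and c: "c > 0" and r: "r > 0"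
    and f: "f ` mspace X = mspace S"
    and diam: "\<And>x y. x \<in> mspace X \<Longrightarrow> y \<in> mspace X \<Longrightarrow> mdist X x y \<le> 2 * r"
    and gap: "\<And>x y. x \<in> mspace X \<Longrightarrow> y \<in> mspace X \<Longrightarrow> f x \<noteq> f y \<Longrightarrow>
      c - 2 * r \<le> mdist X x y"
  shows "GH_dist S X \<le> ereal r"
proof -
  define e where "e = max 0 (c - 2 * r)"
  define q where "q s x = (if s = f x then r else r + e)" for s x
  define M where "M = Inl ` mspace S \<union> Inr ` mspace X"
  define \<delta> where "\<delta> u v = (case (u, v) of
      (Inl s, Inl t) \<Rightarrow> mdist S s t
    | (Inr x, Inr y) \<Rightarrow> mdist X x y
    | (Inl s, Inr x) \<Rightarrow> q s x
    | (Inr x, Inl s) \<Rightarrow> q s x)" for u v :: "'b + 'a"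
  have \<delta>: "\<delta> (Inl s) (Inl t) = mdist S s t" "\<delta> (Inr x) (Inr y) = mdist X x y"
    "\<delta> (Inl s) (Inr x) = q s x" "\<delta> (Inr x) (Inl s) = q s x" for s t x y
    by (simp_all add: \<delta>_def)
  have dS: "mdist S s t = (if s = t then 0 else c)" if "s \<in> mspace S" "t \<in> mspace S" for s t
    using S that by (auto simp: is_simplex_def)
  have gap': "f x = f y \<or> e \<le> mdist X x y" if "x \<in> mspace X" "y \<in> mspace X" for x y
    using gap[OF that] by (auto simp: e_def)
  have e: "0 \<le> e" "e \<le> c" "c - 2 * r \<le> e" using c r by (auto simp: e_def)
  have Z: "Metric_space M \<delta>"
  proof
    fix u v w
    show "0 \<le> \<delta> u v" using r e by (cases u; cases v) (auto simp: \<delta> q_def)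
    show "\<delta> u v = \<delta> v u" by (cases u; cases v) (auto simp: \<delta> mdist_commute)
    assume uv: "u \<in> M" "v \<in> M"
    show "\<delta> u v = 0 \<longleftrightarrow> u = v"
      using uv r e by (cases u; cases v) (auto simp: \<delta> q_def M_def)
    assume w: "w \<in> M"
    have SSX: "q s x \<le> mdist S s t + q t x"
      if "s \<in> mspace S" "t \<in> mspace S" "x \<in> mspace X" for s t x
      using that r e c by (auto simp: q_def dS)
    have SXS: "mdist S s t \<le> q s x + q t x"
      if "s \<in> mspace S" "t \<in> mspace S" "x \<in> mspace X" for s t x
      using that r e c by (auto simp: q_def dS)
    have XXS: "q s y \<le> mdist X x y + q s x"
      if "s \<in> mspace S" "y \<in> mspace X" "x \<in> mspace X" for s x y
      using gap'[of x y] that r e by (auto simp: q_def add_increasing)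
    have XSX: "mdist X x y \<le> q s x + q s y"
      if "s \<in> mspace S" "y \<in> mspace X" "x \<in> mspace X" for s x y
      using diam[of x y] that r e by (auto simp: q_def)
    show "\<delta> u w \<le> \<delta> u v + \<delta> v w"
    proof (cases u; cases v; cases w)
      fix s t z assume [simp]: "u = Inl s" "v = Inl t" "w = Inl z"
      show ?thesis using uv w by (auto simp: \<delta> M_def intro!: mdist_triangle)
    next
      fix s t x assume [simp]: "u = Inl s" "v = Inl t" "w = Inr x"
      show ?thesis using uv w SSX by (auto simp: \<delta> M_def)
    next
      fix s t x assume [simp]: "u = Inl s" "v = Inr x" "w = Inl t"
      show ?thesis using uv w SXS by (auto simp: \<delta> M_def)
    next
      fix s y x assume [simp]: "u = Inl s" "v = Inr x" "w = Inr y"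
      show ?thesis using uv w XXS[of s y x] by (auto simp: \<delta> M_def)
    next
      fix s t x assume [simp]: "u = Inr x" "v = Inl t" "w = Inl s"
      show ?thesis using uv w SSX[of s t x] by (auto simp: \<delta> M_def mdist_commute)
    next
      fix s y x assume [simp]: "u = Inr x" "v = Inl s" "w = Inr y"
      show ?thesis using uv w XSX by (auto simp: \<delta> M_def)
    next
      fix s y x assume [simp]: "u = Inr x" "v = Inr y" "w = Inl s"
      show ?thesis using uv w XXS[of s x y] by (auto simp: \<delta> M_def mdist_commute)
    next
      fix y x z assume [simp]: "u = Inr x" "v = Inr y" "w = Inr z"
      show ?thesis using uv w by (auto simp: \<delta> M_def intro!: mdist_triangle)
    qed
  qed
  define W where "W = metric (M, \<delta>)"
  have W: "mspace W = M" "mdist W = \<delta>"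
    using Z by (simp_all add: W_def Metric_space.mspace_metric Metric_space.mdist_metric)
  have "isometric_onto S W (Inl ` mspace S)" "isometric_onto X W (Inr ` mspace X)"
    unfolding isometric_onto_def
    by (auto simp: W \<delta> bij_betw_def inj_on_def intro!: exI[of _ Inl] exI[of _ Inr])
  moreover have "hausdorff_dist W (Inl ` mspace S) (Inr ` mspace X) \<le> ereal r"
  proof -
    have near: "mset_dist W A B \<le> ereal r" if "Inl (f x) \<in> A" "Inr x \<in> B" for A B x
      unfolding mset_dist_def using that
      by (intro INF_lower2[of "(Inl (f x), Inr x)"]) (auto simp: W \<delta> q_def)
    have "mset_dist W {Inl s} (Inr ` mspace X) \<le> ereal r" if s: "s \<in> mspace S" for s
    proof -
      obtain x where "x \<in> mspace X" "s = f x" using s f by blast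
      then show ?thesis by (intro near[of x]) auto
    qed
    moreover have "mset_dist W (Inl ` mspace S) {Inr x} \<le> ereal r" if "x \<in> mspace X" for x
      using that f by (intro near[of x]) auto
    ultimately show ?thesis
      unfolding hausdorff_dist_def by (auto intro!: SUP_least)
  qed
  ultimately show ?thesis
    by (intro GH_dist_le[of "Inl ` mspace S" W "Inr ` mspace X"]) (auto simp: W M_def)
qed

section \<open>The lower bound: reading a partition off a correspondence\<close>

text \<open>Points of the two copies at distance less than \<open>\<rho> / 2\<close> are related. The strict inequality
  \<open>2 * r < \<rho>\<close> provides partners, since the infima in the Hausdorff distance need not be attained.\<close>

lemma hausdorff_dist_correspondence:
  fixes X :: "'a metric" and Y :: "'b metric" and Z :: "'c metric"
  assumes sub: "X' \<subseteq> mspace Z" "Y' \<subseteq> mspace Z"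
    and iso: "isometric_onto X Z X'" "isometric_onto Y Z Y'"
    and le: "hausdorff_dist Z X' Y' \<le> ereal r" and r: "2 * r < \<rho>"
  obtains R where "\<And>x. x \<in> mspace X \<Longrightarrow> \<exists>y \<in> mspace Y. R x y"
    "\<And>y. y \<in> mspace Y \<Longrightarrow> \<exists>x \<in> mspace X. R x y"
    "\<And>x y x' y'. x \<in> mspace X \<Longrightarrow> x' \<in> mspace X \<Longrightarrow> y \<in> mspace Y \<Longrightarrow> y' \<in> mspace Y \<Longrightarrow>
      R x y \<Longrightarrow> R x' y' \<Longrightarrow> \<bar>mdist X x x' - mdist Y y y'\<bar> \<le> \<rho>"
proof -
  obtain f where f: "bij_betw f (mspace X) X'"
      "\<And>x y. x \<in> mspace X \<Longrightarrow> y \<in> mspace X \<Longrightarrow> mdist Z (f x) (f y) = mdist X x y"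
    using iso(1) unfolding isometric_onto_def by blast
  obtain g where g: "bij_betw g (mspace Y) Y'"
      "\<And>x y. x \<in> mspace Y \<Longrightarrow> y \<in> mspace Y \<Longrightarrow> mdist Z (g x) (g y) = mdist Y x y"
    using iso(2) unfolding isometric_onto_def by blast
  have im: "f ` mspace X = X'" "g ` mspace Y = Y'" using f(1) g(1) by (auto simp: bij_betw_def)
  have lt: "ereal r < ereal (\<rho> / 2)" using r by simp
  have "\<exists>y \<in> mspace Y. mdist Z (f x) (g y) < \<rho> / 2" if x: "x \<in> mspace X" for x
  proof -
    have "mset_dist Z {f x} Y' \<le> (SUP a \<in> X'. mset_dist Z {a} Y')"
      using im x by (intro SUP_upper) auto
    also have "\<dots> < ereal (\<rho> / 2)" using le lt unfolding hausdorff_dist_def by (meson max.bounded_iff le_less_trans)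
    finally show ?thesis unfolding mset_dist_def im(2)[symmetric] by (auto simp: INF_less_iff)
  qed
  moreover have "\<exists>x \<in> mspace X. mdist Z (f x) (g y) < \<rho> / 2" if y: "y \<in> mspace Y" for y
  proof -
    have "mset_dist Z X' {g y} \<le> (SUP b \<in> Y'. mset_dist Z X' {b})"
      using im y by (intro SUP_upper) auto
    also have "\<dots> < ereal (\<rho> / 2)" using le lt unfolding hausdorff_dist_def by (meson max.bounded_iff le_less_trans)
    finally show ?thesis unfolding mset_dist_def im(1)[symmetric] by (auto simp: INF_less_iff)
  qed
  moreover have "\<bar>mdist X x x' - mdist Y y y'\<bar> \<le> \<rho>"
    if "x \<in> mspace X" "x' \<in> mspace X" "y \<in> mspace Y" "y' \<in> mspace Y"
      "mdist Z (f x) (g y) < \<rho> / 2" "mdist Z (f x') (g y') < \<rho> / 2" for x y x' y'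
  proof -
    have Z: "f x \<in> mspace Z" "f x' \<in> mspace Z" "g y \<in> mspace Z" "g y' \<in> mspace Z"
      using im sub that by auto
    have "mdist Z (f x) (f x') \<le> mdist Z (f x) (g y) + mdist Z (g y) (f x')"
      "mdist Z (g y) (f x') \<le> mdist Z (g y) (g y') + mdist Z (g y') (f x')"
      "mdist Z (g y) (g y') \<le> mdist Z (g y) (f x) + mdist Z (f x) (g y')"
      "mdist Z (f x) (g y') \<le> mdist Z (f x) (f x') + mdist Z (f x') (g y')"
      using Z by (auto intro!: mdist_triangle)
    then show ?thesis
      using that f(2) g(2) mdist_commute[of Z "g y" "f x"] mdist_commute[of Z "g y'" "f x'"]
      by (auto simp: abs_le_iff)
  qed
  ultimately show thesis
    using that[of "\<lambda>x y. mdist Z (f x) (g y) < \<rho> / 2"] by blast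
qed

text \<open>The choice of one related element of \<open>C\<close> for every point may miss elements of \<open>C\<close>, so that its
  fibres can be too few; the refinement restores their number without enlarging any of them.\<close>

lemma d_card_le_distortion:
  assumes cov: "\<And>x. x \<in> mspace X \<Longrightarrow> \<exists>s \<in> C. R s x"
    and dis: "\<And>s x y. s \<in> C \<Longrightarrow> x \<in> mspace X \<Longrightarrow> y \<in> mspace X \<Longrightarrow> R s x \<Longrightarrow> R s y \<Longrightarrow>
      mdist X x y \<le> \<rho>"
    and C: "(card_of C, card_of (mspace X)) \<in> ordLeq"
  shows "d_card (card_of C) X \<le> ereal \<rho>"
proof -
  have "\<forall>x \<in> mspace X. \<exists>s. s \<in> C \<and> R s x" using cov by blast
  from bchoice[OF this] obtain f where f: "\<And>x. x \<in> mspace X \<Longrightarrow> f x \<in> C \<and> R (f x) x"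
    by blast
  obtain D where D: "D \<in> partitions_of_card (card_of C) X"
    "\<And>A x y. A \<in> D \<Longrightarrow> x \<in> A \<Longrightarrow> y \<in> A \<Longrightarrow> x \<in> mspace X \<and> y \<in> mspace X \<and> f x = f y"
    using fibres_have_refinement_of_card[of X f C, OF _ C] f by blast
  have small: "mdist X x y \<le> \<rho>" if A: "A \<in> D" "x \<in> A" "y \<in> A" for A x y
  proof -
    have xy: "x \<in> mspace X" "y \<in> mspace X" "f x = f y" using D(2)[OF A] by simp_all
    then have "f x \<in> C" "R (f x) x" "R (f x) y" using f[OF xy(1)] f[OF xy(2)] by simp_all
    then show ?thesis using xy(1,2) by (simp add: dis[of "f x"])
  qed
  have "partition_diam X D \<le> ereal \<rho>"
    unfolding partition_diam_def mdiam_def by (intro SUP_least) (auto intro: small)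
  then show ?thesis unfolding d_card_def by (rule INF_lower2[OF D(1)])
qed

text \<open>Points related to different vertices are at least \<open>c - \<rho>\<close> apart. As this is positive, a point
  is related to one vertex only, so the related points of the vertices are the fibres of a map onto
  the simplex.\<close>

lemma simplex_distortion_ge_alpha:
  assumes S: "is_simplex c S"
    and tot: "\<And>s. s \<in> mspace S \<Longrightarrow> \<exists>x \<in> mspace X. R s x"
    and cov: "\<And>x. x \<in> mspace X \<Longrightarrow> \<exists>s \<in> mspace S. R s x"
    and dis: "\<And>s x t y. s \<in> mspace S \<Longrightarrow> t \<in> mspace S \<Longrightarrow> x \<in> mspace X \<Longrightarrow> y \<in> mspace X \<Longrightarrow>
      R s x \<Longrightarrow> R t y \<Longrightarrow> \<bar>mdist S s t - mdist X x y\<bar> \<le> \<rho>"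
    and \<rho>: "\<rho> < c"
  shows "ereal (c - \<rho>) \<le> alpha_card (card_of (mspace S)) X"
proof -
  have far: "c - \<rho> \<le> mdist X x y"
    if "s \<in> mspace S" "t \<in> mspace S" "x \<in> mspace X" "y \<in> mspace X" "R s x" "R t y" "s \<noteq> t"
    for s t x y
    using dis[OF that(1-6)] that S by (auto simp: is_simplex_def)
  have "\<forall>x \<in> mspace X. \<exists>s. s \<in> mspace S \<and> R s x" using cov by blast
  from bchoice[OF this] obtain f where f: "\<And>x. x \<in> mspace X \<Longrightarrow> f x \<in> mspace S \<and> R (f x) x"
    by blast
  have "s \<in> f ` mspace X" if s: "s \<in> mspace S" for s
  proof -
    obtain x where x: "x \<in> mspace X" "R s x" using tot s by blast
    have "f x = s"
    proof (rule ccontr)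
      assume "f x \<noteq> s"
      then have "c - \<rho> \<le> mdist X x x" using far[of "f x" s x x] f[of x] s x by blast
      moreover have "mdist X x x = 0" using x by simp
      ultimately show False using \<rho> by simp
    qed
    then show ?thesis using x by auto
  qed
  then have img: "f ` mspace X = mspace S" using f by auto
  have D: "(\<lambda>t. {x \<in> mspace X. f x = t}) ` mspace S
      \<in> partitions_of_card (card_of (mspace S)) X" (is "?D \<in> _")
    by (rule fibres_in_partitions_of_card[OF img card_of_refl])
  have "ereal (c - \<rho>) \<le> partition_gap X ?D"
  proof -
    have apart: "c - \<rho> \<le> mdist X x y"
      if "x \<in> mspace X" "y \<in> mspace X" "f x \<noteq> f y" for x y
      using far[of "f x" "f y" x y] f that by simp
    have fib: "ereal (c - \<rho>) \<le> mset_dist X {x \<in> mspace X. f x = s} {x \<in> mspace X. f x = t}"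
      if "s \<noteq> t" for s t
      unfolding mset_dist_def using that by (intro INF_greatest) (auto intro!: apart)
    have "ereal (c - \<rho>) \<le> mset_dist X A B" if AB: "A \<in> ?D" "B \<in> ?D" "A \<noteq> B" for A B
    proof -
      obtain s t where st: "A = {x \<in> mspace X. f x = s}" "B = {x \<in> mspace X. f x = t}"
        using AB(1,2) by blast
      then have "s \<noteq> t" using AB(3) by blast
      then show ?thesis using fib st by simp
    qed
    then show ?thesis
      unfolding partition_gap_def by (intro Inf_greatest) (elim CollectE exE conjE, simp)
  qed
  also have "\<dots> \<le> alpha_card (card_of (mspace S)) X"
    unfolding alpha_card_def by (rule SUP_upper[OF D])
  finally show ?thesis .
qed

section \<open>The distance formula\<close>

theorem corollary2p16:
  fixes X :: "'a metric" and S :: "'b metric" and c :: real and m :: "'b rel"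
  assumes "mspace X \<noteq> {}"
    and "Metric_space.mbounded (mspace X) (mdist X) (mspace X)"
    and "c > 0"
    and "is_simplex c S"
    and "m = card_of (mspace S)"
    and "(m, card_of (mspace X)) \<in> ordLeq"
    and "d_card m X = mdiam X (mspace X)"
  shows "2 * GH_dist S X = max (mdiam X (mspace X)) (ereal c - alpha_card m X) \<and>
    (ereal c \<le> mdiam X (mspace X) + alpha_card m X \<longrightarrow>
      2 * GH_dist S X = mdiam X (mspace X)) \<and>
    (ereal c \<ge> mdiam X (mspace X) + alpha_card m X \<longrightarrow>
      2 * GH_dist S X = ereal c - alpha_card m X)"
proof -
  let ?X = "mspace X" and ?\<alpha> = "alpha_card m X"
  obtain x0 where x0: "x0 \<in> ?X" using assms(1) by blast
  have diam_upper: "ereal (mdist X x y) \<le> mdiam X ?X" if "x \<in> ?X" "y \<in> ?X" for x y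
    unfolding mdiam_def using that by (intro SUP_upper2[of "(x, y)"]) auto
  have "\<exists>B. \<forall>x \<in> ?X. \<forall>y \<in> ?X. mdist X x y \<le> B"
    using assms(2) Metric_space.mbounded_alt[OF Metric_space_mspace_mdist, of X] by auto
  then obtain B where "\<And>x y. x \<in> ?X \<Longrightarrow> y \<in> ?X \<Longrightarrow> mdist X x y \<le> B" by blast
  then have "mdiam X ?X \<le> ereal B" unfolding mdiam_def by (auto intro!: SUP_least)
  moreover have "0 \<le> mdiam X ?X"
    by (rule order_trans[OF _ diam_upper[OF x0 x0]]) simp
  ultimately obtain d where d: "mdiam X ?X = ereal d" "0 \<le> d" by (cases "mdiam X ?X") auto
  have dist_le: "mdist X x y \<le> d" if "x \<in> ?X" "y \<in> ?X" for x y
    using diam_upper[OF that] d by simp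
  \<comment> \<open>Without partitions into \<open>m\<close> parts the infimum defining \<open>d_card m X\<close> would be infinite.\<close>
  have "partitions_of_card m X \<noteq> {}"
    using assms(7) d by (auto simp: d_card_def top_ereal_def)
  then obtain D0 where D0: "D0 \<in> partitions_of_card m X" by blast
  have "0 \<le> partition_gap X D0"
    unfolding partition_gap_def mset_dist_def by (auto intro!: Inf_greatest INF_greatest)
  also have "\<dots> \<le> ?\<alpha>" unfolding alpha_card_def by (rule SUP_upper[OF D0])
  finally have \<alpha>: "0 \<le> ?\<alpha>" .
  \<comment> \<open>The maximum is a real number even for a one-point simplex, where \<open>\<alpha>\<^sub>m(X) = \<infinity>\<close>.\<close>
  define \<mu> where "\<mu> = real_of_ereal (max (ereal d) (ereal c - ?\<alpha>))"
  have \<mu>: "ereal \<mu> = max (ereal d) (ereal c - ?\<alpha>)"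
    using \<alpha> by (cases ?\<alpha>) (auto simp: \<mu>_def max_def)
  have d\<mu>: "d \<le> \<mu>" using \<mu> by (metis ereal_less_eq(3) max.cobounded1)
  have upper: "GH_dist S X \<le> ereal (\<rho> / 2)" if \<rho>: "\<mu> < \<rho>" for \<rho>
  proof -
    \<comment> \<open>The supremum defining \<open>\<alpha>\<^sub>m(X)\<close> need not be attained, hence the slack \<open>\<mu> < \<rho>\<close>.\<close>
    have "ereal c - ?\<alpha> < ereal \<rho>" using \<mu> \<rho> by (metis ereal_less(2) less_ereal.simps(1) max_less_iff_conj)
    then have "ereal (c - \<rho>) < ?\<alpha>" using \<alpha> by (cases ?\<alpha>) auto
    then obtain D where D: "D \<in> partitions_of_card m X" "ereal (c - \<rho>) < partition_gap X D"
      by (auto simp: alpha_card_def less_SUP_iff)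
    obtain f where f: "f ` ?X = mspace S" "\<And>x y. x \<in> ?X \<Longrightarrow> y \<in> ?X \<Longrightarrow> f x \<noteq> f y \<Longrightarrow>
        partition_gap X D \<le> ereal (mdist X x y)"
      using partition_as_fibres[of D "mspace S" X] D(1) assms(5) by blast
    show ?thesis
    proof (rule GH_dist_simplex_le[OF assms(4,3) _ f(1)])
      show "0 < \<rho> / 2" using d d\<mu> \<rho> by simp
      show "mdist X x y \<le> 2 * (\<rho> / 2)" if "x \<in> ?X" "y \<in> ?X" for x y
        using dist_le[OF that] d\<mu> \<rho> by simp
      show "c - 2 * (\<rho> / 2) \<le> mdist X x y" if "x \<in> ?X" "y \<in> ?X" "f x \<noteq> f y" for x y
        using less_le_trans[OF D(2) f(2)[OF that]] by simp
    qed
  qed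
  have lower: "ereal (\<mu> / 2) \<le> GH_dist S X"
    unfolding GH_dist_def
  proof (rule Inf_greatest, clarify)
    fix r and Z :: "('b + 'a) metric" and S' X'
    assume Z: "S' \<subseteq> mspace Z" "X' \<subseteq> mspace Z" "isometric_onto S Z S'" "isometric_onto X Z X'"
      "hausdorff_dist Z S' X' \<le> ereal r"
    have "\<mu> \<le> \<rho>" if \<rho>: "2 * r < \<rho>" for \<rho>
    proof -
      obtain R where R: "\<And>s. s \<in> mspace S \<Longrightarrow> \<exists>x \<in> ?X. R s x"
        "\<And>x. x \<in> ?X \<Longrightarrow> \<exists>s \<in> mspace S. R s x"
        "\<And>s x t y. s \<in> mspace S \<Longrightarrow> t \<in> mspace S \<Longrightarrow> x \<in> ?X \<Longrightarrow> y \<in> ?X \<Longrightarrow>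
          R s x \<Longrightarrow> R t y \<Longrightarrow> \<bar>mdist S s t - mdist X x y\<bar> \<le> \<rho>"
        using hausdorff_dist_correspondence[OF Z \<rho>] by blast
      have "mdist X x y \<le> \<rho>" if "s \<in> mspace S" "x \<in> ?X" "y \<in> ?X" "R s x" "R s y" for s x y
        using R(3)[of s s x y] that mdist_zero[THEN iffD2, of s S s] by simp
      then have "d_card m X \<le> ereal \<rho>"
        using R(2) assms(5,6) by (auto intro!: d_card_le_distortion[where R = R])
      then have d\<rho>: "d \<le> \<rho>" using assms(7) d by simp
      have "ereal c - ?\<alpha> \<le> ereal \<rho>"
      proof (cases "\<rho> < c")
        case True
        have "ereal (c - \<rho>) \<le> ?\<alpha>"
          unfolding assms(5) using simplex_distortion_ge_alpha[OF assms(4) R True] .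
        then show ?thesis by (cases ?\<alpha>) auto
      next
        case False
        then show ?thesis using \<alpha> by (cases ?\<alpha>) auto
      qed
      then have "ereal \<mu> \<le> ereal \<rho>" using \<mu> d\<rho> by simp
      then show ?thesis by simp
    qed
    then have "\<mu> \<le> 2 * r" by (rule dense_ge)
    then show "ereal (\<mu> / 2) \<le> ereal r" by simp
  qed
  have "GH_dist S X \<le> ereal (\<mu> / 2)"
  proof (rule ereal_le_epsilon2)
    fix e :: real assume "0 < e"
    then show "GH_dist S X \<le> ereal (\<mu> / 2) + ereal e"
      using upper[of "\<mu> + 2 * e"] by (simp add: add_divide_distrib)
  qed
  with lower have "GH_dist S X = ereal (\<mu> / 2)" by (rule antisym[rotated])
  then have "2 * GH_dist S X = ereal \<mu>" by simp
  then have eq: "2 * GH_dist S X = max (mdiam X ?X) (ereal c - ?\<alpha>)"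
    using \<mu> d by simp
  show ?thesis
    unfolding eq d(1) using \<alpha> by (cases ?\<alpha>) (auto simp: max_def)
qed

end
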